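(* Let $m$ be an integer with $2 \leq \lfloor m/2 \rfloor - 1$ (that is, $m \geq 6$), and let $f(x) = x^m + x^3 + x^2 + x + 1 \in \mathbb{F}_2[x]$. Then $f(x)$ has an even number of irreducible factors over $\mathbb{F}_2$ if and only if $m \equiv 0, 3, 5$ or $6 \pmod 8$.
   Context: $\mathbb{F}_2$ is the field with two elements. *)

theory Defs
  imports "Berlekamp_Zassenhaus.Finite_Field"
    "HOL-Computational_Algebra.Computational_Algebra"
begin

text \<open>
  In \<open>'a mod_ring\<close> the modulus is the cardinality of the index type \<open>'a\<close>, so taking the
  two-element type \<open>bool\<close> gives the integers modulo \<open>2\<close>, with ring operations modulo \<open>2\<close>
  (addition is exclusive or, not disjunction).
\<close>

type_synonym gf2 = "bool mod_ring"

lemma card_gf2: "CARD(gf2) = 2"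
  by simp

text \<open>
  The number of irreducible factors of a nonzero polynomial, counted with multiplicity;
  associated factors are identified by only considering the monic ones.
\<close>

definition num_irreducible_factors :: "gf2 poly \<Rightarrow> nat" where
  "num_irreducible_factors f =
     (\<Sum>p | irreducible p \<and> lead_coeff p = 1 \<and> p dvd f. multiplicity p f)"

lemma num_irreducible_factors_eq_size:
  assumes "f \<noteq> 0"
  shows "num_irreducible_factors f = size (prime_factorization f)"
proof -
  have norm: "normalize p = p \<longleftrightarrow> lead_coeff p = 1" if "p \<noteq> 0" for p :: "gf2 poly"
  proof -
    have uf: "unit_factor p = [:lead_coeff p:]"
      by (simp only: unit_factor_poly_def unit_factor_mod_ring_def)
    have "normalize p = p \<longleftrightarrow> unit_factor p = 1"
      using that by (metis mult_1 mult_cancel_right unit_factor_mult_normalize)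
    also have "\<dots> \<longleftrightarrow> lead_coeff p = 1"
      unfolding uf one_pCons by (metis pCons_eq_iff)
    finally show ?thesis .
  qed
  have prime_iff: "irreducible p \<and> lead_coeff p = 1 \<longleftrightarrow> prime p" for p :: "gf2 poly"
    unfolding prime_def prime_elem_iff_irreducible
    using norm[of p] by (metis not_irreducible_zero)
  have set_eq: "{p. irreducible p \<and> lead_coeff p = 1 \<and> p dvd f} = prime_factors f"
    unfolding prime_factors_dvd[OF assms] using prime_iff by blast
  have "num_irreducible_factors f = (\<Sum>p\<in>prime_factors f. multiplicity p f)"
    unfolding num_irreducible_factors_def set_eq ..
  also have "\<dots> = (\<Sum>p\<in>prime_factors f. count (prime_factorization f) p)"
    by (rule sum.cong[OF refl])
      (rule count_prime_factorization_prime[symmetric], erule in_prime_factors_imp_prime)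
  also have "\<dots> = size (prime_factorization f)"
    by (rule size_multiset_overloaded_eq[symmetric])
  finally show ?thesis .
qed

end

theory Submission
  imports Defs "HOL-Algebra.Algebraic_Closure_Type"
begin

text \<open>
  Over \<open>\<bbbF>\<^sub>2\<close> the polynomial is \<open>X^m + (X + 1)^3\<close>. The parity of its number of irreducible
  factors is found by Stickelberger's theorem: for a monic lift \<open>F\<close> to characteristic zero of a
  squarefree polynomial of degree \<open>n\<close> over \<open>\<bbbF>\<^sub>2\<close> with \<open>r\<close> irreducible factors, the discriminant
  of \<open>F\<close> is \<open>1\<close> modulo \<open>8\<close> if \<open>n - r\<close> is even, and \<open>5\<close> modulo \<open>8\<close> otherwise.

  To speak about the discriminant modulo \<open>8\<close> in terms of roots one needs a ring in which \<open>F\<close>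
  splits, in which \<open>8 = 0\<close> but \<open>5 \<noteq> 1\<close>, and which carries a lift of the Frobenius map. The Witt vectors
  of length three over an algebraic closure of \<open>\<bbbF>\<^sub>2\<close> are such a ring, and they can be written down as
  explicit triples. In this ring every simple root of the reduction lifts uniquely
  (\<open>hensel\<close>, \<open>hensel_unique\<close>), so that the Frobenius map permutes the lifted roots as squaring permutes
  the roots below.

  The roots of one irreducible factor of degree \<open>d\<close> form one cycle of length \<open>d\<close> under squaring
  (\<open>irreducible_gf2_splits\<close>). Hence the Frobenius map multiplies the Vandermonde product
  \<open>\<Prod>\<^sub>i\<^sub><\<^sub>j (x\<^sub>i - x\<^sub>j)\<close> of that cycle by \<open>(-1)^(d - 1)\<close>. A Frobenius-invariant unit of
  the ring is an odd residue modulo \<open>8\<close>, with square \<open>1\<close>, while a unit that the Frobenius map negates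
  has square \<open>5\<close>. The cross terms between two different cycles are invariant, so they contribute
  the square \<open>1\<close>. The discriminant is therefore \<open>5\<close> to the number of factors of even
  degree, which is congruent to \<open>n - r\<close> modulo \<open>2\<close>; this is \<open>stickelberger_gf2\<close>.

  The discriminant of \<open>F = X^m + (X + 1)^3\<close> has a closed form. At a root \<open>x\<close> of \<open>F\<close> the relation
  \<open>x^m = -(x + 1)^3\<close> turns \<open>x F'(x)\<close> into \<open>(x + 1)\<^sup>2 ((3 - m) x - m)\<close>, and the product of a linear form
  over all roots is a value of \<open>F\<close> made homogeneous. Up to the sign \<open>(-1)^(m choose 2)\<close> the result is
  \<open>m^m + 27 (3 - m)^(m - 3)\<close> (\<open>discriminant_power_plus_cube\<close>), and its residue modulo \<open>8\<close> depends only
  on \<open>m\<close> modulo \<open>8\<close>.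
\<close>

section \<open>Witt vectors of length three over the closure of the two-element field\<close>

text \<open>
  The construction of the algebraic closure brings along polynomials and divisibility notions over
  explicit carriers under the same names; the type-class versions are meant throughout.
\<close>

hide_const (open) Polynomials.degree Polynomials.lead_coeff Divisibility.prime Divisibility.irreducible

type_synonym gf2_closure = "gf2 alg_closure"

lemma char_2 [simp]: "(x :: gf2_closure) + x = 0"
proof -
  have "of_nat CHAR(gf2_closure) = (0 :: gf2_closure)" by (rule of_nat_CHAR)
  then have "(2::gf2_closure) = 0" by simp
  then show ?thesis by (metis mult_2 mult_zero_left)
qed

lemma two_eq_0 [simp]: "(2 :: gf2_closure) = 0"
  using char_2[of 1] by (simp only: one_add_one)

lemma char_2_left [simp]: "(x :: gf2_closure) + (x + y) = y"
  by (simp flip: add.assoc)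

lemma uminus_char_2 [simp]: "- (x :: gf2_closure) = x"
  by (rule minus_unique) simp

lemma diff_char_2: "(x :: gf2_closure) - y = x + y"
  by (metis diff_conv_add_uminus uminus_char_2)

text \<open>
  A triple \<open>W a b c\<close> stands for \<open>[a] + 2 [b]' + 4 [c]''\<close>, where \<open>[_]\<close> is the multiplicative
  lift and the primes are square and fourth roots. The formulas for sum and product
  are the universal Witt polynomials for the prime \<open>2\<close>, reduced modulo \<open>2\<close>.
\<close>

datatype witt = W (res: gf2_closure) (coord_1: gf2_closure) (coord_2: gf2_closure)

instantiation witt :: comm_ring_1
begin
definition "0 = W 0 0 0"
definition "1 = W 1 0 0"
fun plus_witt where
  "W a b c + W a' b' c' =
     W (a + a') (b + b' + a * a')
       (c + c' + b * b' + a * a' * (b + b') + a ^ 3 * a' + a * a' ^ 3)"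
fun uminus_witt where
  "- W a b c = W a (b + a^2) (c + b^2 + a^2 * b + a^4)"
definition "(x :: witt) - y = x + - y"
fun times_witt where
  "W a b c * W a' b' c' =
     W (a * a') (a^2 * b' + a'^2 * b)
       (a^4 * c' + a'^4 * c + b^2 * b'^2 + a^2 * a'^2 * b * b')"
instance
proof
  fix x y z :: witt
  obtain a b c where x: "x = W a b c" by (cases x)
  obtain d e f where y: "y = W d e f" by (cases y)
  obtain g h i where z: "z = W g h i" by (cases z)
  show "x + y + z = x + (y + z)"
    unfolding x y z by (simp add: algebra_simps power2_eq_square power3_eq_cube)
  show "x + y = y + x" unfolding x y by (simp add: algebra_simps)
  show "0 + x = x" unfolding x zero_witt_def by simp
  show "- x + x = 0"  unfolding x zero_witt_def
    by (simp add: algebra_simps power2_eq_square power3_eq_cube power4_eq_xxxx)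
  show "x - y = x + - y" by (rule minus_witt_def)
  show "x * y = y * x" unfolding x y by (simp add: algebra_simps)
  show "1 * x = x" unfolding x one_witt_def by simp
  show "x * y * z = x * (y * z)" unfolding x y z
    by (simp add: algebra_simps power2_eq_square power3_eq_cube power4_eq_xxxx)
  show "(x + y) * z = x * z + y * z" unfolding x y z
    by (simp add: algebra_simps power2_eq_square power3_eq_cube power4_eq_xxxx)
  show "(0 :: witt) \<noteq> 1" by (simp add: zero_witt_def one_witt_def)
qed
end

lemma res_add [simp]: "res (x + y) = res x + res y"
  by (cases x; cases y) simp

lemma res_mult [simp]: "res (x * y) = res x * res y"
  by (cases x; cases y) simp

lemma res_0 [simp]: "res 0 = 0" and res_1 [simp]: "res 1 = 1"
  by (simp_all add: zero_witt_def one_witt_def)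

lemma res_uminus [simp]: "res (- x) = - res x"
  by (cases x) simp

lemma res_diff [simp]: "res (x - y) = res x - res y"
  by (simp only: minus_witt_def res_add res_uminus diff_char_2 uminus_char_2)

lemma res_power [simp]: "res (x ^ n) = res x ^ n"
  by (induction n) simp_all

lemma res_prod_list: "res (prod_list xs) = prod_list (map res xs)"
  by (induction xs) simp_all

lemma res_witt_eq_0_iff: "res x = 0 \<longleftrightarrow> (\<exists>b c. x = W 0 b c)"
  by (cases x) auto

text \<open>
  The kernel of the residue map is nilpotent, so inverses lift from the residue field by a
  finite geometric series.
\<close>

lemma unit_witt:
  assumes "res x \<noteq> 0"
  shows "\<exists>y. x * y = 1"
proof -
  define t where "t = W (inverse (res x)) 0 0"
  define h where "h = 1 - x * t"
  have "res h = 0" using assms by (simp add: h_def t_def)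
  then obtain b c where h: "h = W 0 b c" by (auto simp: res_witt_eq_0_iff)
  have "h * h * h = 0" by (simp add: h zero_witt_def)
  then have "(1 - h) * (1 + h + h * h) = 1" by (simp add: algebra_simps)
  then have "x * (t * (1 + h + h * h)) = 1" by (simp add: h_def algebra_simps)
  then show ?thesis by blast
qed

lemma cancel_unit_witt:
  assumes "res x \<noteq> 0" "x * y = 0"
  shows "y = 0"
proof -
  obtain u where u: "x * u = 1" using unit_witt[OF assms(1)] by blast
  have "y = (x * u) * y" by (simp only: u mult_1)
  also have "\<dots> = u * (x * y)" by (simp only: mult_ac)
  finally show ?thesis by (simp add: assms(2))
qed

text \<open>
  The defining polynomials of the ring operations have coefficients in \<open>\<bbbF>\<^sub>2\<close>, so squaring all
  coordinates commutes with them.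
\<close>

definition frob :: "witt \<Rightarrow> witt" where
  "frob x = W (res x ^ 2) (coord_1 x ^ 2) (coord_2 x ^ 2)"

lemma res_frob [simp]: "res (frob x) = res x ^ 2"
  by (simp add: frob_def)

lemma square_add: "((x :: gf2_closure) + y) ^ 2 = x ^ 2 + y ^ 2"
  by (simp add: power2_eq_square algebra_simps)

lemma frob_0 [simp]: "frob 0 = 0" and frob_1 [simp]: "frob 1 = 1"
  by (simp_all add: frob_def zero_witt_def one_witt_def)

lemma frob_add [simp]: "frob (x + y) = frob x + frob y"
  by (cases x; cases y,
      simp only: frob_def plus_witt.simps times_witt.simps witt.sel square_add power_mult_distrib,
      simp add: power2_eq_square power3_eq_cube power4_eq_xxxx mult_ac add_ac)

lemma frob_mult [simp]: "frob (x * y) = frob x * frob y"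
  by (cases x; cases y,
      simp only: frob_def plus_witt.simps times_witt.simps witt.sel square_add power_mult_distrib,
      simp add: power2_eq_square power3_eq_cube power4_eq_xxxx mult_ac add_ac)

lemma frob_uminus [simp]: "frob (- x) = - frob x"
  by (metis add_eq_0_iff frob_0 frob_add)

lemma frob_diff [simp]: "frob (x - y) = frob x - frob y"
  by (metis diff_conv_add_uminus frob_add frob_uminus)

lemma frob_prod_list: "frob (prod_list xs) = prod_list (map frob xs)"
  by (induction xs) simp_all

lemma idem_gf2_closure: "(a :: gf2_closure) ^ 2 = a \<longleftrightarrow> a = 0 \<or> a = 1"
  by (auto simp: power2_eq_square)

text \<open>
  An invariant element has coordinates in \<open>\<bbbF>\<^sub>2\<close>, so it is a residue modulo \<open>8\<close>; if it is a unit it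
  is odd, and odd squares are \<open>1\<close> modulo \<open>8\<close>.
\<close>

lemma square_eq_1_if_frob_fixed:
  assumes "frob z = z" "res z \<noteq> 0"
  shows "z ^ 2 = 1"
proof -
  obtain a b c where z: "z = W a b c" by (cases z)
  have "a = 1" "b = 0 \<or> b = 1" "c = 0 \<or> c = 1"
    using assms by (auto simp: z frob_def idem_gf2_closure)
  then show ?thesis by (auto simp: z power2_eq_square one_witt_def)
qed

lemma five_witt: "(5 :: witt) = W 1 0 1"
proof -
  have "(5 :: witt) = 1 + 1 + 1 + 1 + 1" by simp
  also have "\<dots> = W 1 0 1" unfolding one_witt_def by (simp del: one_add_one)
  finally show ?thesis .
qed

text \<open>
  The square of \<open>W 1 b c\<close> is \<open>W 1 0 (b^4 + b^2)\<close>. Negation by the Frobenius map forces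
  \<open>b^2 = b + 1\<close>, so \<open>b\<close> lies outside \<open>\<bbbF>\<^sub>2\<close> and \<open>b^4 + b^2 = 1\<close>: the element is a square root of \<open>5\<close> that
  exists only after adjoining the cube roots of unity.
\<close>

lemma square_eq_5_if_frob_anti_fixed:
  assumes "frob z = - z" "res z \<noteq> 0"
  shows "z ^ 2 = 5"
proof -
  obtain a b c where z: "z = W a b c" by (cases z)
  have a: "a = 1" and b: "b ^ 2 = b + 1" using assms
    by (auto simp: z frob_def idem_gf2_closure)
  have "b ^ 4 + b ^ 2 = (b ^ 2) ^ 2 + b ^ 2" by (simp flip: power_mult)
  also have "\<dots> = 1" by (simp add: b square_add)
  finally have "b ^ 4 + b ^ 2 = 1" .
  then show ?thesis unfolding five_witt
    by (simp add: z a power2_eq_square power4_eq_xxxx add_ac mult_ac)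
qed

section \<open>Derivatives and lifting of simple roots\<close>

text \<open>
  The derivative of \<open>p\<close> at \<open>a\<close>, as the value at \<open>a\<close> of the difference quotient
  \<open>(p - p(a)) / (X - a)\<close>; unlike \<open>pderiv\<close> it makes sense over rings with zero divisors, such as
  the Witt vectors.
\<close>

definition deriv_at :: "'a :: comm_ring_1 poly \<Rightarrow> 'a \<Rightarrow> 'a" where
  "deriv_at p a = poly (synthetic_div p a) a"

lemma deriv_at_0 [simp]: "deriv_at 0 a = 0"
  and deriv_at_1 [simp]: "deriv_at 1 a = 0"
  and deriv_at_pCons [simp]: "deriv_at (pCons k p) a = poly p a + a * deriv_at p a"
  by (simp_all add: deriv_at_def one_pCons)

lemma deriv_at_add [simp]: "deriv_at (p + q) a = deriv_at p a + deriv_at q a"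
proof (induction p arbitrary: q)
  case (pCons k p)
  show ?case
  proof (cases q)
    case (pCons k' q')
    have "deriv_at (p + q') a = deriv_at p a + deriv_at q' a" by (rule pCons.IH)
    then show ?thesis unfolding pCons add_pCons deriv_at_pCons poly_add
      by (simp only: algebra_simps)
  qed
qed simp

lemma deriv_at_smult [simp]: "deriv_at (smult c p) a = c * deriv_at p a"
  by (induction p) (simp_all add: algebra_simps)

lemma deriv_at_mult [simp]:
  "deriv_at (p * q) a = deriv_at p a * poly q a + poly p a * deriv_at q a"
  by (induction p) (simp_all add: algebra_simps)

lemma taylor_2: "\<exists>c. poly p (a + h) = poly p a + h * deriv_at p a + h ^ 2 * c"
proof (induction p)
  case 0
  show ?case by (rule exI[of _ 0]) simp
next
  case (pCons k p)
  then obtain c where c: "poly p (a + h) = poly p a + h * deriv_at p a + h ^ 2 * c"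
    by blast
  show ?case
    by (rule exI[of _ "deriv_at p a + a * c + h * c"])
      (simp add: c algebra_simps power2_eq_square)
qed

lemma res_poly_cong: "res a = res b \<Longrightarrow> res (poly p a) = res (poly p b)"
  by (induction p) simp_all

lemma res_deriv_at_cong: "res a = res b \<Longrightarrow> res (deriv_at p a) = res (deriv_at p b)"
  by (induction p) (simp_all add: res_poly_cong[of a b])

text \<open>
  A Newton step cancels the linear terms of the Taylor expansion, so it squares the error. Here \<open>u\<close> is
  the negated inverse of the derivative at \<open>a\<close>.
\<close>

lemma hensel_step:
  assumes "res (poly p a) = 0" "res (deriv_at p a) \<noteq> 0"
  obtains b u c where "b = a + poly p a * u" "poly p b = (poly p a) ^ 2 * c"
proof -
  obtain u where u: "deriv_at p a * u = 1" using unit_witt[OF assms(2)] by blast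
  obtain c where c: "poly p (a + poly p a * (- u)) = poly p a + poly p a * (- u) * deriv_at p a
      + (poly p a * (- u)) ^ 2 * c"
    using taylor_2[of p a "poly p a * (- u)"] by blast
  also have "\<dots> = poly p a * (1 - deriv_at p a * u) + poly p a ^ 2 * (u ^ 2 * c)"
    by (simp add: algebra_simps power2_eq_square)
  also have "\<dots> = poly p a ^ 2 * (u ^ 2 * c)" by (simp add: u)
  finally show ?thesis using that by blast
qed

lemma hensel:
  assumes "res (poly p a) = 0" "res (deriv_at p a) \<noteq> 0"
  shows "\<exists>b. res b = res a \<and> poly p b = 0"
proof -
  obtain b u c where b: "b = a + poly p a * u" "poly p b = poly p a ^ 2 * c"
    using hensel_step[OF assms] .
  have res_b: "res b = res a" by (simp add: b(1) assms)
  obtain b' u' c' where b': "b' = b + poly p b * u'" "poly p b' = poly p b ^ 2 * c'"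
    using hensel_step[of p b] assms res_poly_cong[OF res_b] res_deriv_at_cong[OF res_b] by metis
  obtain s t where "poly p a = W 0 s t" using assms(1) by (auto simp: res_witt_eq_0_iff)
  \<comment> \<open>the fourth power of the first error vanishes, so two Newton steps reach an exact root\<close>
  then have "(poly p a ^ 2) ^ 2 = 0" by (simp add: power2_eq_square zero_witt_def)
  then have "poly p b' = 0" by (simp add: b'(2) b(2) power_mult_distrib)
  moreover have "res b' = res a" by (simp add: b'(1) res_b b(2) assms)
  ultimately show ?thesis by blast
qed

text \<open>
  The Taylor expansion of \<open>p\<close> at \<open>b\<close> writes \<open>0 = p(a) - p(b)\<close> as \<open>a - b\<close> times a unit.
\<close>

lemma hensel_unique:
  assumes "res a = res b" "poly p a = 0" "poly p b = 0" "res (deriv_at p b) \<noteq> 0"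
  shows "a = b"
proof -
  obtain c where "poly p (b + (a - b)) = poly p b + (a - b) * deriv_at p b + (a - b) ^ 2 * c"
    using taylor_2 by blast
  then have "(deriv_at p b + (a - b) * c) * (a - b) = 0"
    using assms by (simp add: algebra_simps power2_eq_square)
  moreover have "res (deriv_at p b + (a - b) * c) \<noteq> 0" using assms by simp
  ultimately have "a - b = 0" using cancel_unit_witt by blast
  then show ?thesis by simp
qed

section \<open>Products of linear factors and Vandermonde products\<close>

definition linear_factors :: "'a :: comm_ring_1 list \<Rightarrow> 'a poly" where
  "linear_factors xs = (\<Prod>x\<leftarrow>xs. [:- x, 1:])"

lemma linear_factors_Nil [simp]: "linear_factors [] = 1"
  and linear_factors_Cons: "linear_factors (x # xs) = [:- x, 1:] * linear_factors xs"
  and linear_factors_append: "linear_factors (xs @ ys) = linear_factors xs * linear_factors ys"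
  by (simp_all add: linear_factors_def)

lemma poly_linear_factors: "poly (linear_factors xs) y = (\<Prod>x\<leftarrow>xs. y - x)"
  by (induction xs) (simp_all add: linear_factors_Cons algebra_simps)

lemma poly_linear_factors_root: "x \<in> set xs \<Longrightarrow> poly (linear_factors xs) x = 0"
  by (induction xs) (auto simp: linear_factors_Cons)

lemma degree_linear_factors_eq: "degree (linear_factors xs) = length xs"
  and monic_linear_factors: "lead_coeff (linear_factors xs) = 1"
proof (induction xs)
  case (Cons x xs)
  have lf: "linear_factors xs \<noteq> 0" using Cons.IH(2) by force
  have *: "lead_coeff [:- x, 1:] = 1" by simp
  case 1
  show ?case using degree_monic_mult[OF * lf] Cons.IH(1) by (simp add: linear_factors_Cons)
  case 2
  show ?case using lcoeff_monic_mult[OF *, of "linear_factors xs"] degree_monic_mult[OF * lf] Cons.IH(2)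
    by (simp add: linear_factors_Cons)
qed simp_all

text \<open>
  Over a ring with zero divisors, distinct roots alone do not split off linear factors together;
  it is enough that no difference of two roots is a zero divisor.
\<close>

definition regular_differences :: "'a :: comm_ring_1 list \<Rightarrow> bool" where
  "regular_differences = sorted_wrt (\<lambda>x y. \<forall>z. (y - x) * z = 0 \<longrightarrow> z = 0)"

lemma linear_factors_dvd:
  assumes "regular_differences xs" "\<And>x. x \<in> set xs \<Longrightarrow> poly p x = 0"
  shows "linear_factors xs dvd p"
  using assms
proof (induction xs arbitrary: p)
  case (Cons x xs)
  have "poly p x = 0" using Cons.prems(2) by simp
  then obtain q where q: "p = [:- x, 1:] * q" unfolding poly_eq_0_iff_dvd by (elim dvdE)
  have "poly q y = 0" if "y \<in> set xs" for y
  proof -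
    have "(y - x) * poly q y = poly p y" by (simp add: q algebra_simps)
    then have "(y - x) * poly q y = 0" using Cons.prems(2) that by simp
    then show ?thesis using Cons.prems(1) that by (simp add: regular_differences_def)
  qed
  then have "linear_factors xs dvd q"
    using Cons.IH Cons.prems(1) by (simp add: regular_differences_def)
  then show ?case unfolding q linear_factors_Cons by (rule mult_dvd_mono[OF dvd_refl])
qed simp

lemma linear_factors_eqI:
  assumes "regular_differences xs" "\<And>x. x \<in> set xs \<Longrightarrow> poly p x = 0"
    and "lead_coeff p = 1" "degree p = length xs"
  shows "p = linear_factors xs"
proof -
  obtain q where q: "p = linear_factors xs * q" using linear_factors_dvd[OF assms(1,2)] by (meson dvdE)
  have "q \<noteq> 0" using assms(3) q by force
  then have deg: "degree p = length xs + degree q"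
    using degree_monic_mult[OF monic_linear_factors \<open>q \<noteq> 0\<close>] q
    by (simp add: degree_linear_factors_eq)
  then have "degree q = 0" using assms(4) by simp
  moreover have "lead_coeff p = lead_coeff q"
    using lcoeff_monic_mult[OF monic_linear_factors, of xs q] deg
    by (simp add: q degree_linear_factors_eq)
  ultimately have "q = 1" using assms(3) by (metis monic_degree_0)
  then show ?thesis using q by simp
qed

fun vandermonde :: "'a :: comm_ring_1 list \<Rightarrow> 'a" where
  "vandermonde [] = 1"
| "vandermonde (x # xs) = (\<Prod>y\<leftarrow>xs. x - y) * vandermonde xs"

definition diff_prod :: "'a :: comm_ring_1 list \<Rightarrow> 'a list \<Rightarrow> 'a" where
  "diff_prod xs ys = (\<Prod>x\<leftarrow>xs. \<Prod>y\<leftarrow>ys. x - y)"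

lemma vandermonde_append:
  "vandermonde (xs @ ys) = vandermonde xs * vandermonde ys * diff_prod xs ys"
  by (induction xs) (simp_all add: diff_prod_def mult_ac)

lemma prod_list_cong_mset:
  assumes "mset xs = mset ys"
  shows "(\<Prod>x\<leftarrow>xs. f x) = (\<Prod>x\<leftarrow>ys. f x :: 'a :: comm_monoid_mult)"
proof -
  have "mset (map f xs) = mset (map f ys)" using assms by simp
  then show ?thesis by (metis prod_mset_prod_list)
qed

lemma diff_prod_cong_mset:
  assumes "mset xs = mset xs'" "mset ys = mset ys'"
  shows "diff_prod xs ys = diff_prod xs' ys'"
proof -
  have "(\<Prod>y\<leftarrow>ys. x - y) = (\<Prod>y\<leftarrow>ys'. x - y)" for x
    by (rule prod_list_cong_mset[OF assms(2)])
  then show ?thesis unfolding diff_prod_def using prod_list_cong_mset[OF assms(1)] by simp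
qed

lemma prod_list_swap_diff:
  fixes x :: "'a :: comm_ring_1"
  shows "(\<Prod>y\<leftarrow>xs. y - x) = (- 1) ^ length xs * (\<Prod>y\<leftarrow>xs. x - y)"
  by (induction xs) (simp_all add: algebra_simps)

lemma prod_list_mult_distrib:
  fixes f g :: "'b \<Rightarrow> 'a :: comm_monoid_mult"
  shows "(\<Prod>x\<leftarrow>xs. f x * g x) = (\<Prod>x\<leftarrow>xs. f x) * (\<Prod>x\<leftarrow>xs. g x)"
  by (induction xs) (simp_all add: mult_ac)

lemma vandermonde_rotate1:
  assumes "xs \<noteq> []"
  shows "vandermonde (rotate1 xs) = (- 1) ^ (length xs - 1) * vandermonde xs"
proof -
  obtain x ys where xs: "xs = x # ys" using assms by (cases xs) auto
  show ?thesis
    by (simp add: xs vandermonde_append diff_prod_def prod_list_swap_diff mult_ac)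
qed

text \<open>
  The discriminant from the derivatives: \<open>F'(x)\<close> is the product of \<open>x - y\<close> over the other roots \<open>y\<close>,
  so every pair of roots occurs in both orders, and the reversals produce the sign.
\<close>

lemma prod_deriv_at_linear_factors:
  "(\<Prod>x\<leftarrow>xs. deriv_at (linear_factors xs) x)
     = (- 1) ^ (length xs choose 2) * vandermonde xs ^ 2"
proof (induction xs)
  case (Cons x xs)
  have tail: "deriv_at (linear_factors (x # xs)) y = (y - x) * deriv_at (linear_factors xs) y"
    if "y \<in> set xs" for y
    using poly_linear_factors_root[OF that]
    by (simp only: linear_factors_Cons deriv_at_mult) simp
  have head: "deriv_at (linear_factors (x # xs)) x = (\<Prod>y\<leftarrow>xs. x - y)"
    by (simp only: linear_factors_Cons deriv_at_mult) (simp add: poly_linear_factors)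
  have "(\<Prod>y\<leftarrow>x # xs. deriv_at (linear_factors (x # xs)) y)
      = (\<Prod>y\<leftarrow>xs. x - y) * (\<Prod>y\<leftarrow>xs. (y - x) * deriv_at (linear_factors xs) y)"
    using tail by (simp add: head cong: map_cong)
  also have "\<dots> = (\<Prod>y\<leftarrow>xs. x - y) * ((- 1) ^ length xs * (\<Prod>y\<leftarrow>xs. x - y))
      * ((- 1) ^ (length xs choose 2) * vandermonde xs ^ 2)"
    by (simp only: prod_list_mult_distrib Cons.IH prod_list_swap_diff mult_ac)
  also have "\<dots> = (- 1) ^ (length xs + (length xs choose 2)) * vandermonde (x # xs) ^ 2"
    by (simp add: power_add power_mult_distrib power2_eq_square mult_ac)
  also have "length xs + (length xs choose 2) = (length (x # xs) choose 2)"
    by (simp add: numeral_2_eq_2)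
  finally show ?case .
qed (simp add: numeral_2_eq_2)

text \<open>
  The value at \<open>(d, c)\<close> of the form \<open>c^n p(d / c)\<close> of degree \<open>n\<close>. It yields the product of a linear
  form over the roots even if neither of its coefficients is invertible.
\<close>

definition homogenized_value :: "nat \<Rightarrow> 'a :: comm_ring_1 poly \<Rightarrow> 'a \<Rightarrow> 'a \<Rightarrow> 'a" where
  "homogenized_value n p d c = (\<Sum>k\<le>n. coeff p k * d ^ k * c ^ (n - k))"

lemma homogenized_value_add:
  "homogenized_value n (p + q) d c = homogenized_value n p d c + homogenized_value n q d c"
  by (simp add: homogenized_value_def sum.distrib algebra_simps)

lemma homogenized_value_monom:
  assumes "k \<le> n"
  shows "homogenized_value n (monom a k) d c = a * d ^ k * c ^ (n - k)"
proof -
  have "homogenized_value n (monom a k) d c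
      = (\<Sum>i\<le>n. if i = k then a * d ^ k * c ^ (n - k) else 0)"
    unfolding homogenized_value_def by (rule sum.cong) auto
  then show ?thesis using assms by simp
qed

lemma homogenized_value_linear_factors:
  "homogenized_value (length xs) (linear_factors xs) d c = (\<Prod>x\<leftarrow>xs. d - c * x)"
proof (induction xs)
  case (Cons x xs)
  let ?p = "linear_factors xs" and ?n = "length xs"
  have "homogenized_value (Suc ?n) (smult (- x) ?p) d c = - x * c * homogenized_value ?n ?p d c"
    using coeff_eq_0[of ?p "Suc ?n"]
    by (simp add: homogenized_value_def degree_linear_factors_eq sum_distrib_left
        Suc_diff_le mult_ac flip: sum_negf)
  moreover have "homogenized_value (Suc ?n) (pCons 0 ?p) d c = d * homogenized_value ?n ?p d c"
    by (simp add: homogenized_value_def sum.atMost_Suc_shift sum_distrib_left mult_ac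
        del: sum.atMost_Suc)
  moreover have "linear_factors (x # xs) = smult (- x) ?p + pCons 0 ?p"
    by (simp add: linear_factors_Cons)
  ultimately show ?case
    by (simp add: homogenized_value_add Cons.IH algebra_simps del: smult_minus_left)
qed (simp add: homogenized_value_def)

section \<open>The discriminant of a union of Frobenius cycles\<close>

lemma regular_differences_witt:
  "distinct (map res xs) \<Longrightarrow> regular_differences xs"
proof (induction xs)
  case (Cons x xs)
  have "z = 0" if "y \<in> set xs" "(y - x) * z = 0" for y z
  proof (rule cancel_unit_witt[OF _ that(2)])
    have "res y \<in> res ` set xs" "res x \<notin> res ` set xs" using Cons.prems that(1) by auto
    then have "res y \<noteq> res x" by metis
    then show "res (y - x) \<noteq> 0" by simp
  qed
  then show ?case using Cons by (simp add: regular_differences_def)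
qed (simp add: regular_differences_def)

lemma regular_differences_field:
  "distinct (xs :: 'a :: field list) \<Longrightarrow> regular_differences xs"
  by (induction xs) (auto simp: regular_differences_def)

lemma res_vandermonde: "res (vandermonde xs) = vandermonde (map res xs)"
  by (induction xs) (simp_all add: res_prod_list o_def)

lemma frob_vandermonde: "frob (vandermonde xs) = vandermonde (map frob xs)"
  by (induction xs) (simp_all add: frob_prod_list o_def)

lemma frob_diff_prod: "frob (diff_prod xs ys) = diff_prod (map frob xs) (map frob ys)"
  by (simp add: diff_prod_def frob_prod_list o_def)

lemma vandermonde_neq_0: "distinct (xs :: 'a :: field list) \<Longrightarrow> vandermonde xs \<noteq> 0"
  by (induction xs) (auto simp: prod_list_zero_iff)

text \<open>
  A product over all pairs from two lists does not see their order, so the Frobenius map fixes it; it is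
  a unit because the residues of the two lists do not meet.
\<close>

lemma diff_prod_square_eq_1:
  assumes "mset (map frob xs) = mset xs" "mset (map frob ys) = mset ys"
    and "distinct (map res (xs @ ys))"
  shows "diff_prod xs ys ^ 2 = 1"
proof (rule square_eq_1_if_frob_fixed)
  show "frob (diff_prod xs ys) = diff_prod xs ys"
    unfolding frob_diff_prod by (rule diff_prod_cong_mset[OF assms(1,2)])
  have "res (vandermonde (xs @ ys)) \<noteq> 0"
    unfolding res_vandermonde by (rule vandermonde_neq_0[OF assms(3)])
  then show "res (diff_prod xs ys) \<noteq> 0" by (simp add: vandermonde_append)
qed

text \<open>
  On a cycle of length \<open>d\<close> the Frobenius map rotates the list of roots, which is a permutation of
  sign \<open>(-1)^(d - 1)\<close>.
\<close>

lemma vandermonde_square_cycle: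
  assumes "map frob xs = rotate1 xs" "distinct (map res xs)"
  shows "vandermonde xs ^ 2 = (if xs \<noteq> [] \<and> even (length xs) then 5 else 1)"
proof (cases "xs = []")
  case False
  have nz: "res (vandermonde xs) \<noteq> 0"
    unfolding res_vandermonde by (rule vandermonde_neq_0[OF assms(2)])
  have "frob (vandermonde xs) = (- 1) ^ (length xs - 1) * vandermonde xs"
    unfolding frob_vandermonde assms(1) by (rule vandermonde_rotate1[OF False])
  moreover have "odd (length xs - 1) \<longleftrightarrow> even (length xs)" using False by simp
  ultimately show ?thesis
    using square_eq_1_if_frob_fixed[OF _ nz] square_eq_5_if_frob_anti_fixed[OF _ nz] False
    by (cases "even (length xs)") simp_all
qed simp

lemma five_five: "(5 :: witt) * 5 = 1"
  unfolding five_witt one_witt_def by simp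

lemma five_neq_1: "(5 :: witt) \<noteq> 1"
  unfolding five_witt one_witt_def by simp

text \<open>
  The square is \<open>5\<close> to the number of cycles of even length. That number has the parity of the total
  length plus the number of cycles, because \<open>\<Sum> (d - 1)\<close> counts modulo \<open>2\<close> exactly the even \<open>d\<close>.
\<close>

lemma vandermonde_square_cycles:
  assumes "\<And>xs. xs \<in> set xss \<Longrightarrow> map frob xs = rotate1 xs \<and> xs \<noteq> []"
    and "distinct (map res (concat xss))"
  shows "vandermonde (concat xss) ^ 2
    = (if even (length (concat xss) + length xss) then 1 else 5)"
  using assms
proof (induction xss)
  case (Cons xs xss)
  have stable: "mset (map frob ys) = mset ys" if "ys \<in> set (xs # xss)" for ys
    using Cons.prems(1)[OF that] by (cases ys) simp_all
  have "mset (map frob (concat xss)) = mset (concat xss)"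
    using stable by (induction xss) auto
  then have "diff_prod xs (concat xss) ^ 2 = 1"
    using diff_prod_square_eq_1[of xs "concat xss"] stable Cons.prems(2) by simp
  then have "vandermonde (concat (xs # xss)) ^ 2 = vandermonde xs ^ 2 * vandermonde (concat xss) ^ 2"
    by (simp add: vandermonde_append power_mult_distrib)
  moreover have "vandermonde xs ^ 2 = (if even (length xs) then 5 else 1)"
    using vandermonde_square_cycle[of xs] Cons.prems by auto
  moreover have "vandermonde (concat xss) ^ 2
    = (if even (length (concat xss) + length xss) then 1 else 5)"
    using Cons by simp
  ultimately show ?case using five_five by auto
qed simp

section \<open>Roots of polynomials over the two-element field\<close>

interpretation to_ac_poly: map_poly_inj_idom_hom "to_ac :: gf2 \<Rightarrow> gf2_closure"
  by unfold_locales simp_all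

interpretation square_poly: map_poly_idom_hom "\<lambda>x :: gf2_closure. x ^ 2"
  by unfold_locales (simp_all add: square_add power_mult_distrib)

interpretation res_poly: map_poly_comm_ring_hom res
  by unfold_locales simp_all

interpretation frob_poly: map_poly_comm_ring_hom frob
  by unfold_locales simp_all

lemma gf2_cases: "(x :: gf2) = 0 \<or> x = 1"
proof -
  obtain i where "i < CARD(bool)" "x = of_nat i" using surj_of_nat_mod_ring[of x] by blast
  moreover have "i = 0 \<or> i = 1" using calculation(1) by auto
  ultimately show ?thesis by auto
qed

lemma lead_coeff_gf2: "(p :: gf2 poly) \<noteq> 0 \<Longrightarrow> lead_coeff p = 1"
  using gf2_cases[of "lead_coeff p"] by simp

lemma square_to_ac: "to_ac (x :: gf2) ^ 2 = to_ac x"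
  using gf2_cases[of x] by auto

lemma poly_gf2_square:
  "poly (map_poly to_ac (p :: gf2 poly)) (x ^ 2) = poly (map_poly to_ac p) x ^ 2"
proof -
  have "map_poly (\<lambda>x. x ^ 2) (map_poly to_ac p) = map_poly to_ac p"
    by (rule poly_eqI) (simp add: square_to_ac coeff_map_poly)
  then show ?thesis using square_poly.base.poly_map_poly[of "map_poly to_ac p" x] by metis
qed

lemma square_inj: "(x :: gf2_closure) ^ 2 = y ^ 2 \<Longrightarrow> x = y"
proof -
  assume "x ^ 2 = y ^ 2"
  then have "(x + y) ^ 2 = 0" by (simp add: square_add)
  then have "x + y = 0" by simp
  then show "x = y" by (metis char_2_left add.right_neutral)
qed

lemma pow2_inj: "(x :: gf2_closure) ^ (2 ^ n) = y ^ (2 ^ n) \<Longrightarrow> x = y"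
proof (induction n)
  case (Suc n)
  then have "(x ^ (2 ^ n)) ^ 2 = (y ^ (2 ^ n)) ^ 2"
    by (simp add: mult.commute flip: power_mult)
  then show ?case using Suc.IH square_inj by blast
qed simp

lemma poly_gf2_pow2:
  "poly (map_poly to_ac (p :: gf2 poly)) (x ^ (2 ^ n)) = poly (map_poly to_ac p) x ^ (2 ^ n)"
proof (induction n)
  case (Suc n)
  have "poly (map_poly to_ac p) (x ^ (2 ^ Suc n)) = poly (map_poly to_ac p) ((x ^ (2 ^ n)) ^ 2)"
    by (simp add: mult.commute flip: power_mult)
  also have "\<dots> = poly (map_poly to_ac p) x ^ (2 ^ Suc n)"
    unfolding poly_gf2_square Suc by (simp add: mult.commute flip: power_mult)
  finally show ?case .
qed simp

lemma conjugates_periodic: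
  assumes "p \<noteq> 0" "poly (map_poly to_ac (p :: gf2 poly)) x = 0"
  shows "\<exists>e>0. x ^ (2 ^ e) = x"
proof -
  let ?g = "\<lambda>n. x ^ (2 ^ n)"
  have "range ?g \<subseteq> {y. poly (map_poly to_ac p) y = 0}"
    using assms(2) by (auto simp: poly_gf2_pow2)
  moreover have "finite {y. poly (map_poly to_ac p) y = 0}"
    using assms(1) by (intro poly_roots_finite) simp
  ultimately have "finite (range ?g)" by (rule finite_subset)
  then have "\<not> inj ?g" using finite_imageD infinite_UNIV_nat by blast
  then obtain i j where "i < j" "?g i = ?g j" unfolding inj_def by (metis nat_neq_iff)
  then have "x ^ (2 ^ i) = (x ^ (2 ^ (j - i))) ^ (2 ^ i)"
    by (simp flip: power_mult power_add)
  then show ?thesis using pow2_inj[of x i] \<open>i < j\<close> by (metis zero_less_diff)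
qed

lemma linear_factors_cong_mset: "mset xs = mset ys \<Longrightarrow> linear_factors xs = linear_factors ys"
  unfolding linear_factors_def by (rule prod_list_cong_mset)

lemma map_poly_square_linear_factors:
  "map_poly (\<lambda>x. x ^ 2) (linear_factors xs) = linear_factors (map (\<lambda>x :: gf2_closure. x ^ 2) xs)"
  by (induction xs) (simp_all add: linear_factors_Cons square_poly.hom_mult
      del: mult_pCons_left)

text \<open>
  The fixed field of the squaring map is \<open>\<bbbF>\<^sub>2\<close>.
\<close>

lemma poly_over_gf2:
  assumes "map_poly (\<lambda>x. x ^ 2) q = q"
  shows "\<exists>q0 :: gf2 poly. map_poly to_ac q0 = q"
proof
  have "to_ac (of_ac (coeff q i) :: gf2) = coeff q i" for i
  proof -
    have "coeff q i ^ 2 = coeff q i" using assms by (metis square_poly.base.hom_zero coeff_map_poly)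
    then have "coeff q i \<in> range (to_ac :: gf2 \<Rightarrow> _)"
      unfolding idem_gf2_closure by (metis rangeI to_ac_0 to_ac_1)
    then show ?thesis by (rule to_ac_of_ac)
  qed
  then show "map_poly to_ac (map_poly of_ac q :: gf2 poly) = q"
    by (intro poly_eqI) (simp add: coeff_map_poly)
qed

lemma irreducible_dvd_if_common_root:
  fixes p q :: "gf2 poly"
  assumes "irreducible p" "poly (map_poly to_ac p) x = 0" "poly (map_poly to_ac q) x = 0"
  shows "p dvd q"
proof (rule ccontr)
  assume "\<not> p dvd q"
  moreover have "prime_elem p" using assms(1) by (rule irreducible_imp_prime_elem)
  ultimately have "coprime p q" by (simp add: prime_elem_imp_coprime)
  then obtain a b where "a * p + b * q = 1"
    using bezout_coefficients_fst_snd[of p q] by (auto simp: coprime_iff_gcd_eq_1)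
  then have "map_poly to_ac (a * p + b * q) = (1 :: gf2_closure poly)" by simp
  then have "poly (map_poly to_ac a * map_poly to_ac p + map_poly to_ac b * map_poly to_ac q) x
      = poly (1 :: gf2_closure poly) x"
    by (simp only: to_ac_poly.hom_add to_ac_poly.hom_mult)
  then show False using assms(2,3) by simp
qed

text \<open>
  Let \<open>x\<close> be a root and \<open>e\<close> the length of its cycle under squaring. The product of \<open>X - y\<close> over the
  cycle divides \<open>p\<close>, because the \<open>y\<close> are distinct roots. It is also invariant under squaring of
  coefficients, hence defined over \<open>\<bbbF>\<^sub>2\<close> with root \<open>x\<close>, hence divisible by \<open>p\<close>.
\<close>

lemma irreducible_gf2_splits:
  fixes p :: "gf2 poly"
  assumes "irreducible p"
  shows "\<exists>xs. xs \<noteq> [] \<and> map (\<lambda>x. x ^ 2) xs = rotate1 xs \<and> map_poly to_ac p = linear_factors xs"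
proof -
  have "p \<noteq> 0" using assms by auto
  have "degree (map_poly to_ac p) > 0"
    using assms by (auto simp: Factorial_Ring.irreducible_def is_unit_iff_degree)
  then obtain x where x: "poly (map_poly to_ac p) x = 0"
    using alg_closed_imp_poly_has_root by blast
  define e where "e = (LEAST e. e > 0 \<and> x ^ (2 ^ e) = x)"
  have e: "e > 0" "x ^ (2 ^ e) = x"
    using LeastI_ex[OF conjugates_periodic[OF \<open>p \<noteq> 0\<close> x]] by (simp_all add: e_def)
  have min: "x ^ (2 ^ i) \<noteq> x" if "0 < i" "i < e" for i
    using not_less_Least[of i "\<lambda>e. e > 0 \<and> x ^ (2 ^ e) = x"] that by (auto simp: e_def)
  define xs where "xs = map (\<lambda>i. x ^ (2 ^ i)) [0..<e]"
  have neq: "x ^ (2 ^ i) \<noteq> x ^ (2 ^ j)" if "i < j" "j < e" for i j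
  proof
    assume "x ^ (2 ^ i) = x ^ (2 ^ j)"
    also have "\<dots> = (x ^ (2 ^ (j - i))) ^ (2 ^ i)"
      using that by (simp flip: power_mult power_add)
    finally have "x = x ^ (2 ^ (j - i))" by (rule pow2_inj)
    then show False using min[of "j - i"] that less_imp_diff_less[of j e i] by simp
  qed
  have "inj_on (\<lambda>i. x ^ (2 ^ i)) {0..<e}"
    by (rule linorder_inj_onI) (use neq in auto)
  then have distinct: "distinct xs" by (simp add: xs_def distinct_map)
  have "map (\<lambda>x. x ^ 2) xs = map (\<lambda>i. x ^ (2 ^ i)) [Suc 0..<Suc e]"
    unfolding xs_def map_Suc_upt[symmetric] by (simp add: mult.commute flip: power_mult)
  also have "\<dots> = map (\<lambda>i. x ^ (2 ^ i)) [Suc 0..<e] @ [x]"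
    using e by simp
  also have "\<dots> = rotate1 xs"
    unfolding xs_def using e(1) by (simp add: upt_conv_Cons)
  finally have rot: "map (\<lambda>x. x ^ 2) xs = rotate1 xs" .
  have "mset (map (\<lambda>x. x ^ 2) xs) = mset xs"
    unfolding rot by (cases xs) simp_all
  then have "map_poly (\<lambda>x. x ^ 2) (linear_factors xs) = linear_factors xs"
    unfolding map_poly_square_linear_factors by (rule linear_factors_cong_mset)
  then obtain q :: "gf2 poly" where q: "map_poly to_ac q = linear_factors xs"
    using poly_over_gf2 by blast
  have "x \<in> set xs" using e(1) unfolding xs_def by (force intro: image_eqI[of _ _ 0])
  then have "poly (map_poly to_ac q) x = 0" unfolding q by (rule poly_linear_factors_root)
  then obtain r where r: "q = p * r"
    using irreducible_dvd_if_common_root[OF assms x] by (meson dvdE)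
  have "q \<noteq> 0" using q monic_linear_factors[of xs] by force
  have "linear_factors xs dvd map_poly to_ac p"
  proof (rule linear_factors_dvd[OF regular_differences_field[OF distinct]])
    fix y assume "y \<in> set xs"
    then show "poly (map_poly to_ac p) y = 0"
      using x by (auto simp: xs_def poly_gf2_pow2)
  qed
  then have "degree q \<le> degree p"
    using dvd_imp_degree_le[of "linear_factors xs" "map_poly to_ac p"] \<open>p \<noteq> 0\<close>
    by (simp flip: q)
  then have "degree r = 0" using r \<open>q \<noteq> 0\<close> by (auto simp: degree_mult_eq)
  then have "r = 1" using lead_coeff_gf2[of r] r \<open>q \<noteq> 0\<close> monic_degree_0[of r] by auto
  then have "map_poly to_ac p = linear_factors xs" using q r by simp
  moreover have "xs \<noteq> []" using e(1) by (simp add: xs_def)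
  ultimately show ?thesis using rot by blast
qed

lemma gf2_poly_splits:
  fixes f :: "gf2 poly"
  assumes "f \<noteq> 0"
  shows "\<exists>xss. length xss = num_irreducible_factors f \<and>
    (\<forall>xs\<in>set xss. xs \<noteq> [] \<and> map (\<lambda>x. x ^ 2) xs = rotate1 xs) \<and>
    map_poly to_ac f = linear_factors (concat xss)"
proof -
  obtain ps where ps: "mset ps = prime_factorization f" using ex_mset by blast
  have irr: "irreducible p" if "p \<in> set ps" for p
  proof -
    have "p \<in># prime_factorization f" using that by (simp flip: ps)
    then show ?thesis
      by (intro prime_elem_imp_irreducible prime_imp_prime_elem in_prime_factors_imp_prime)
  qed
  have split: "\<exists>xss. length xss = length ps \<and>
      (\<forall>xs\<in>set xss. xs \<noteq> [] \<and> map (\<lambda>x. x ^ 2) xs = rotate1 xs) \<and>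
      map_poly to_ac (prod_list ps) = linear_factors (concat xss)"
    using irr
  proof (induction ps)
    case Nil
    show ?case by (rule exI[of _ "[]"]) simp
  next
    case (Cons p ps)
    obtain xss where "length xss = length ps"
      "\<forall>xs\<in>set xss. xs \<noteq> [] \<and> map (\<lambda>x. x ^ 2) xs = rotate1 xs"
      "map_poly to_ac (prod_list ps) = linear_factors (concat xss)"
      using Cons by auto
    moreover obtain xs where "xs \<noteq> []" "map (\<lambda>x. x ^ 2) xs = rotate1 xs"
      "map_poly to_ac p = linear_factors xs"
      using irreducible_gf2_splits Cons.prems by auto
    ultimately show ?case
      by (intro exI[of _ "xs # xss"]) (simp add: linear_factors_append to_ac_poly.hom_mult)
  qed
  have "prod_list ps = f"
  proof -
    have "normalize (prod_list ps) = normalize f"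
      using prod_mset_prime_factorization_weak[OF assms] by (simp add: prod_mset_prod_list flip: ps)
    moreover have "prod_list ps \<noteq> 0" using irr by (auto simp: prod_list_zero_iff)
    ultimately show ?thesis
      using normalize_monic lead_coeff_gf2 assms by metis
  qed
  moreover have "length ps = num_irreducible_factors f"
    by (simp add: num_irreducible_factors_eq_size[OF assms] flip: ps)
  ultimately show ?thesis using split by simp
qed

text \<open>
  The product of the derivatives at the roots is, up to sign, the square of the Vandermonde product,
  and that vanishes as soon as an entry is repeated.
\<close>

lemma distinct_if_separable:
  fixes xs :: "'a :: field list"
  assumes "\<And>x. x \<in> set xs \<Longrightarrow> deriv_at (linear_factors xs) x \<noteq> 0"
  shows "distinct xs"
proof -
  have "(\<Prod>x\<leftarrow>xs. deriv_at (linear_factors xs) x) \<noteq> 0"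
    using assms by (auto simp: prod_list_zero_iff)
  then have "vandermonde xs \<noteq> 0" by (auto simp: prod_deriv_at_linear_factors)
  then show ?thesis by (induction xs) (auto simp: prod_list_zero_iff)
qed

section \<open>Stickelberger's theorem modulo eight\<close>

lemma res_poly: "res (poly F a) = poly (map_poly res F) (res a)"
  by simp

lemma res_deriv_at: "res (deriv_at F a) = deriv_at (map_poly res F) (res a)"
  by (induction F) (simp_all add: res_poly.map_poly_pCons_hom)

text \<open>
  Stickelberger's theorem at the prime \<open>2\<close>. The invariance of \<open>F\<close> says that its coefficients are
  residues modulo \<open>8\<close>; it makes the Frobenius map permute the roots of \<open>F\<close>.
\<close>

theorem stickelberger_gf2:
  fixes f :: "gf2 poly" and F :: "witt poly"
  assumes lift: "map_poly res F = map_poly to_ac f"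
    and "lead_coeff F = 1" "map_poly frob F = F"
    and separable: "\<And>x. poly (map_poly to_ac f) x = 0 \<Longrightarrow> deriv_at (map_poly to_ac f) x \<noteq> 0"
  shows "\<exists>xs. F = linear_factors xs \<and>
    vandermonde xs ^ 2 = (if even (degree f + num_irreducible_factors f) then 1 else 5)"
proof -
  have *: "coeff (map_poly res F) (degree F) = 1"
    using assms(2) by (simp only: res_poly.base.coeff_map_poly_hom res_1)
  then have nz: "map_poly res F \<noteq> 0" and "degree (map_poly res F) \<ge> degree F"
    using le_degree[of "map_poly res F" "degree F"] by (force, simp)
  then have deg: "degree F = degree f" using degree_map_poly_le[of res F] lift by simp
  have "f \<noteq> 0" using nz lift by auto
  then obtain xss where xss: "length xss = num_irreducible_factors f"
      "\<And>xs. xs \<in> set xss \<Longrightarrow> xs \<noteq> [] \<and> map (\<lambda>x. x ^ 2) xs = rotate1 xs"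
      "map_poly to_ac f = linear_factors (concat xss)"
    using gf2_poly_splits by blast
  have root: "poly (map_poly to_ac f) x = 0" if "x \<in> set (concat xss)" for x
    unfolding xss(3) using that by (rule poly_linear_factors_root)
  have "distinct (concat xss)"
    by (rule distinct_if_separable) (use separable root xss(3) in auto)

  \<comment> \<open>lift the roots; by uniqueness lifting turns squaring into the Frobenius map\<close>
  have deriv: "res (deriv_at F a) \<noteq> 0" if "poly (map_poly to_ac f) (res a) = 0" for a
    unfolding res_deriv_at lift using that by (rule separable)
  have "\<exists>b. res b = x \<and> poly F b = 0" if "poly (map_poly to_ac f) x = 0" for x
    using hensel[of F "W x 0 0"] deriv[of "W x 0 0"] that by (simp add: res_poly lift)
  then obtain root_lift where rl:
    "\<And>x. poly (map_poly to_ac f) x = 0 \<Longrightarrow> res (root_lift x) = x \<and> poly F (root_lift x) = 0"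
    by metis
  have frob_rl: "frob (root_lift x) = root_lift (x ^ 2)" if "poly (map_poly to_ac f) x = 0" for x
  proof (rule hensel_unique)
    have sq: "poly (map_poly to_ac f) (x ^ 2) = 0" using that by (simp add: poly_gf2_square)
    show "res (frob (root_lift x)) = res (root_lift (x ^ 2))" using rl[OF that] rl[OF sq] by simp
    show "poly F (frob (root_lift x)) = 0"
      using frob_poly.base.poly_map_poly[of F "root_lift x"] assms(3) rl[OF that] by simp
    show "poly F (root_lift (x ^ 2)) = 0" using rl[OF sq] by simp
    show "res (deriv_at F (root_lift (x ^ 2))) \<noteq> 0" using deriv rl[OF sq] sq by simp
  qed

  define yss where "yss = map (map root_lift) xss"
  have concat: "concat yss = map root_lift (concat xss)" by (simp add: yss_def map_concat)
  have res: "map res (concat yss) = concat xss"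
    unfolding concat map_map by (rule map_idI) (use rl root in auto)
  have "F = linear_factors (concat yss)"
  proof (rule linear_factors_eqI)
    show "regular_differences (concat yss)"
      by (rule regular_differences_witt) (simp only: res \<open>distinct (concat xss)\<close>)
    show "poly F y = 0" if "y \<in> set (concat yss)" for y
      using that rl root unfolding concat by auto
    have "degree f = length (concat xss)"
      using arg_cong[OF xss(3), of degree] by (simp add: degree_linear_factors_eq del: length_concat)
    also have "\<dots> = length (concat yss)" unfolding concat by simp
    finally show "degree F = length (concat yss)" using deg by simp
  qed (rule assms(2))
  moreover have "vandermonde (concat yss) ^ 2
      = (if even (length (concat yss) + length yss) then 1 else 5)"
  proof (rule vandermonde_square_cycles)
    show "distinct (map res (concat yss))" by (simp only: res \<open>distinct (concat xss)\<close>)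
    fix ys assume "ys \<in> set yss"
    then obtain xs where xs: "xs \<in> set xss" "ys = map root_lift xs" by (auto simp: yss_def)
    have "map frob ys = map root_lift (map (\<lambda>x. x ^ 2) xs)"
      using xs frob_rl root by auto
    also have "\<dots> = rotate1 ys" using xss(2)[OF xs(1)] by (simp add: xs(2) rotate1_map)
    finally show "map frob ys = rotate1 ys \<and> ys \<noteq> []" using xss(2)[OF xs(1)] xs(2) by simp
  qed
  moreover have "length (concat yss) = degree f"
    using \<open>F = linear_factors (concat yss)\<close> deg degree_linear_factors_eq by metis
  moreover have "length yss = num_irreducible_factors f" by (simp add: yss_def xss(1))
  ultimately show ?thesis by auto
qed

section \<open>The discriminant of the lifted polynomial\<close>

text \<open>
  The polynomial \<open>X^m + (X + 1)^3\<close>, written out so that its coefficients can be read off.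
\<close>

definition power_plus_cube :: "nat \<Rightarrow> 'a :: comm_ring_1 poly" where
  "power_plus_cube m = monom 1 m + monom 1 3 + monom 3 2 + monom 3 1 + monom 1 0"

lemma poly_power_plus_cube: "poly (power_plus_cube m) x = x ^ m + (x + 1) ^ 3"
  by (simp add: power_plus_cube_def poly_monom power3_eq_cube power2_eq_square algebra_simps)

lemma monic_power_plus_cube:
  assumes "m > 3"
  shows "degree (power_plus_cube m :: 'a :: comm_ring_1 poly) = m"
    and "lead_coeff (power_plus_cube m :: 'a :: comm_ring_1 poly) = 1"
proof -
  let ?p = "power_plus_cube m :: 'a poly"
  have "coeff ?p m = 1" using assms by (simp add: power_plus_cube_def)
  moreover have "coeff ?p k = 0" if "k > m" for k using assms that by (simp add: power_plus_cube_def)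
  ultimately show "degree ?p = m" "lead_coeff ?p = 1"
    by (metis (mono_tags, lifting) degree_le le_antisym le_degree zero_neq_one)+
qed

lemma deriv_at_monom: "deriv_at (monom c n) x = of_nat n * c * x ^ (n - 1)"
proof (induction n)
  case (Suc n)
  have "deriv_at (monom c (Suc n)) x = c * x ^ n + of_nat n * c * (x * x ^ (n - 1))"
    by (simp add: monom_Suc Suc poly_monom mult_ac)
  also have "\<dots> = of_nat (Suc n) * c * x ^ n" by (cases n) (simp_all add: algebra_simps)
  finally show ?case by simp
qed (simp add: monom_0)

lemma deriv_at_power_plus_cube:
  fixes x :: "'a :: comm_ring_1"
  assumes "poly (power_plus_cube m) x = 0" "m > 0"
  shows "x * deriv_at (power_plus_cube m) x = (x + 1) ^ 2 * ((3 - of_nat m) * x - of_nat m)"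
proof -
  have pow: "x ^ m = - ((x + 1) ^ 3)" using assms(1) by (simp add: poly_power_plus_cube eq_neg_iff_add_eq_0)
  have "x * deriv_at (power_plus_cube m) x = of_nat m * x ^ m + 3 * x * (x + 1) ^ 2"
    using assms(2)
    by (cases m) (simp_all add: power_plus_cube_def deriv_at_monom power2_eq_square algebra_simps)
  also have "\<dots> = (x + 1) ^ 2 * ((3 - of_nat m) * x - of_nat m)"
    unfolding pow by (simp add: power3_eq_cube power2_eq_square algebra_simps)
  finally show ?thesis .
qed

lemma prod_list_uminus:
  fixes f :: "'b \<Rightarrow> 'a :: comm_ring_1"
  shows "(\<Prod>x\<leftarrow>xs. - f x) = (- 1) ^ length xs * (\<Prod>x\<leftarrow>xs. f x)"
  by (induction xs) simp_all

lemma prod_list_power: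
  fixes f :: "'b \<Rightarrow> 'a :: comm_monoid_mult"
  shows "(\<Prod>x\<leftarrow>xs. f x ^ k) = (\<Prod>x\<leftarrow>xs. f x) ^ k"
  by (induction xs) (simp_all add: power_mult_distrib)

text \<open>
  Multiply \<open>x F'(x) = (x + 1)\<^sup>2 ((3 - m) x - m)\<close> over all roots. The products of the \<open>x\<close> and of the
  \<open>x + 1\<close> are \<open>\<plusminus>F(0)\<close> and \<open>\<plusminus>F(-1)\<close>, both units. The product of the linear forms comes from the
  homogeneous form of \<open>F\<close> at \<open>(m, 3 - m)\<close>, where the sum of the two arguments is \<open>3\<close> and the cube
  becomes \<open>27\<close>.
\<close>

lemma discriminant_power_plus_cube:
  fixes xs :: "'a :: comm_ring_1 list"
  assumes "m > 3" and xs: "power_plus_cube m = linear_factors xs"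
  shows "(- 1) ^ (m choose 2) * vandermonde xs ^ 2
    = of_nat m ^ m + 27 * (3 - of_nat m) ^ (m - 3)"
proof -
  let ?s = "(- 1) ^ m :: 'a" and ?d = "of_nat m :: 'a" and ?c = "3 - of_nat m :: 'a"
  have len: "length xs = m"
    using monic_power_plus_cube(1)[OF assms(1), where 'a = 'a] degree_linear_factors_eq[of xs] xs by simp
  have ss: "?s * ?s = 1" by (simp flip: power_mult_distrib)
  have "(\<Prod>x\<leftarrow>xs. - x) = 1"
    using poly_linear_factors[of xs 0] assms(1)
    by (simp add: poly_power_plus_cube power_0_left flip: xs)
  then have "?s * (\<Prod>x\<leftarrow>xs. x) = 1" by (simp only: prod_list_uminus len)
  then have "?s * ?s * (\<Prod>x\<leftarrow>xs. x) = ?s" by (simp only: mult.assoc mult_1_right)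
  then have prod: "(\<Prod>x\<leftarrow>xs. x) = ?s" by (simp only: ss mult_1)
  have "(\<Prod>x\<leftarrow>xs. - 1 - x) = ?s"
    using poly_linear_factors[of xs "- 1"] by (simp add: poly_power_plus_cube flip: xs)
  moreover have "- 1 - x = - (x + 1)" for x :: 'a by simp
  ultimately have "?s * (\<Prod>x\<leftarrow>xs. x + 1) = ?s" by (simp only: prod_list_uminus len)
  then have "?s * ?s * (\<Prod>x\<leftarrow>xs. x + 1) = ?s * ?s" by (simp only: mult.assoc)
  then have prod1: "(\<Prod>x\<leftarrow>xs. x + 1) = 1" by (simp only: ss mult_1)
  have "(\<Prod>x\<leftarrow>xs. ?d - ?c * x) = homogenized_value m (power_plus_cube m) ?d ?c"
    using homogenized_value_linear_factors[of xs ?d ?c] by (simp add: len xs)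
  also have "\<dots> = ?d ^ m + (?d ^ 3 * ?c ^ (m - 3) + 3 * ?d ^ 2 * ?c ^ (m - 2)
      + 3 * ?d * ?c ^ (m - 1) + ?c ^ m)"
    using assms(1) by (simp add: power_plus_cube_def homogenized_value_add homogenized_value_monom
        del: monom_eq_1)
  also have "?d ^ 3 * ?c ^ (m - 3) + 3 * ?d ^ 2 * ?c ^ (m - 2) + 3 * ?d * ?c ^ (m - 1) + ?c ^ m
      = (?d + ?c) ^ 3 * ?c ^ (m - 3)"
  proof -
    obtain k where k: "m = k + 3" using assms(1) by (metis less_imp_le le_add_diff_inverse2)
    show ?thesis unfolding k
      by (simp add: power_add power3_eq_cube power2_eq_square algebra_simps del: of_nat_add)
  qed
  finally have hom: "(\<Prod>x\<leftarrow>xs. - (?c * x - ?d)) = ?d ^ m + 27 * ?c ^ (m - 3)" by simp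

  have "?s * ((- 1) ^ (m choose 2) * vandermonde xs ^ 2)
      = (\<Prod>x\<leftarrow>xs. x) * (\<Prod>x\<leftarrow>xs. deriv_at (power_plus_cube m) x)"
    unfolding prod xs prod_deriv_at_linear_factors len ..
  also have "\<dots> = (\<Prod>x\<leftarrow>xs. x * deriv_at (power_plus_cube m) x)"
    by (simp only: prod_list_mult_distrib)
  also have "\<dots> = (\<Prod>x\<leftarrow>xs. (x + 1) ^ 2 * (?c * x - ?d))"
  proof (rule arg_cong[of _ _ prod_list], rule map_cong[OF refl])
    fix x assume "x \<in> set xs"
    then have "poly (power_plus_cube m) x = 0" unfolding xs by (rule poly_linear_factors_root)
    then show "x * deriv_at (power_plus_cube m) x = (x + 1) ^ 2 * (?c * x - ?d)"
      using assms(1) by (intro deriv_at_power_plus_cube) auto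
  qed
  also have "\<dots> = (\<Prod>x\<leftarrow>xs. ?c * x - ?d)"
    by (simp only: prod_list_mult_distrib prod_list_power prod1 power_one mult_1)
  also have "\<dots> = ?s * (?d ^ m + 27 * ?c ^ (m - 3))"
    unfolding hom[symmetric] prod_list_uminus len by (simp add: ss flip: mult.assoc)
  finally have "?s * (?s * ((- 1) ^ (m choose 2) * vandermonde xs ^ 2))
      = ?s * (?s * (?d ^ m + 27 * ?c ^ (m - 3)))" by simp
  then show ?thesis by (simp only: mult.assoc[symmetric] ss mult_1)
qed

lemma odd_power_mod_8:
  fixes a :: int
  assumes "odd a" "odd n"
  shows "[a ^ n = a] (mod 8)"
proof -
  have "a mod 8 \<in> {1, 3, 5, 7}" using assms(1) by simp presburger
  then have "(a mod 8) ^ 2 mod 8 = 1" by auto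
  then have "[a ^ 2 = 1] (mod 8)" by (simp add: cong_def power_mod)
  then have "[(a ^ 2) ^ (n div 2) * a = 1 ^ (n div 2) * a] (mod 8)"
    by (intro cong_mult cong_pow cong_refl)
  moreover have "(a ^ 2) ^ (n div 2) * a = a ^ n"
    using assms(2) by (metis odd_two_times_div_two_succ power_add power_mult power_one_right)
  ultimately show ?thesis by simp
qed

lemma even_power_mod_8:
  fixes a :: int
  assumes "even a" "n \<ge> 3"
  shows "[a ^ n = 0] (mod 8)"
proof -
  have "(2 :: int) ^ 3 dvd a ^ n" using assms by (meson dvd_power_le)
  then show ?thesis by (simp add: cong_0_iff)
qed

lemma even_choose_two: "even (m choose 2) \<longleftrightarrow> m mod 4 \<in> {0, 1}"
proof -
  have *: "2 * (m choose 2) = m * (m - 1)"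
  proof -
    have "even (m * (m - 1))" by (cases m) auto
    then show ?thesis by (simp only: choose_two dvd_mult_div_cancel)
  qed
  obtain q r where m: "m = 4 * q + r" "r < 4"
    by (metis mod_less_divisor mult_div_mod_eq zero_less_numeral)
  have "r = 0 \<or> r = 1 \<or> r = 2 \<or> r = 3" using m(2) by auto
  then have "\<exists>k. (m choose 2) = 2 * k + (if r \<in> {0, 1} then 0 else 1)"
  proof (elim disjE)
    assume "r = 0"
    then show ?thesis using * by (intro exI[of _ "q * (m - 1)"]) (simp add: m)
  next
    assume "r = 1"
    then show ?thesis using * by (intro exI[of _ "q * m"]) (simp add: m)
  next
    assume r: "r = 2"
    note *
    also have "m * (m - 1) = 2 * (2 * (4 * q * q + 3 * q) + 1)"
      by (simp add: m(1) r algebra_simps)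
    finally have "2 * (m choose 2) = \<dots>" .
    then show ?thesis using r by (intro exI[of _ "4 * q * q + 3 * q"]) simp
  next
    assume r: "r = 3"
    note *
    also have "m * (m - 1) = 2 * (2 * (4 * q * q + 5 * q + 1) + 1)"
      by (simp add: m(1) r algebra_simps)
    finally have "2 * (m choose 2) = \<dots>" .
    then show ?thesis using r by (intro exI[of _ "4 * q * q + 5 * q + 1"]) simp
  qed
  then show ?thesis using m by (auto split: if_splits)
qed

text \<open>
  One of \<open>m\<close> and \<open>3 - m\<close> is even, and its power vanishes modulo \<open>8\<close> because the exponents are at least \<open>3\<close>.
  The other one is odd with odd exponent, so the power reduces to the base.
\<close>

lemma discriminant_mod_8:
  assumes "m \<ge> 6"
  shows "((- 1) ^ (m choose 2) * (int m ^ m + 27 * (3 - int m) ^ (m - 3))) mod 8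
    = (if even m \<longleftrightarrow> m mod 8 \<in> {0, 3, 5, 6} then 1 else 5)"
proof -
  define N where "N = int m ^ m + 27 * (3 - int m) ^ (m - 3)"
  have "[N = (if even m then 27 * (3 - int m) else int m)] (mod 8)"
  proof (cases "even m")
    case True
    have "[N = 0 + 27 * (3 - int m)] (mod 8)"
      unfolding N_def using True assms
      by (intro cong_add cong_mult cong_refl even_power_mod_8 odd_power_mod_8) auto
    then show ?thesis using True by simp
  next
    case False
    have "[N = int m + 27 * 0] (mod 8)"
      unfolding N_def using False assms
      by (intro cong_add cong_mult cong_refl even_power_mod_8 odd_power_mod_8) auto
    then show ?thesis using False by simp
  qed
  moreover have "[27 * (3 - int m) = 27 * (3 - int (m mod 8))] (mod 8)" "[int m = int (m mod 8)] (mod 8)"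
    by (intro cong_mult cong_refl cong_diff, simp_all add: cong_def zmod_int)
  ultimately have N: "N mod 8 = (if even m then 27 * (3 - int (m mod 8)) else int (m mod 8)) mod 8"
    by (auto simp: cong_def)
  have sign: "(- 1 :: int) ^ (m choose 2) = (if m mod 4 \<in> {0, 1} then 1 else - 1)"
    using even_choose_two[of m] by (auto simp: minus_one_power_iff)
  define r where "r = m mod 8"
  have even: "even m \<longleftrightarrow> even r" and mod4: "m mod 4 = r mod 4"
    unfolding r_def by (simp_all add: dvd_mod_iff mod_mod_cancel)
  have neg: "(- N) mod 8 = (- (N mod 8)) mod 8" by (simp add: mod_minus_eq)
  have "r = 0 \<or> r = 1 \<or> r = 2 \<or> r = 3 \<or> r = 4 \<or> r = 5 \<or> r = 6 \<or> r = 7"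
    unfolding r_def by presburger
  then show ?thesis
    unfolding sign N_def[symmetric] even mod4 r_def[symmetric]
    using N[folded r_def, unfolded even] neg by (elim disjE) simp_all
qed

lemma eight_witt: "(8 :: witt) = 0"
proof -
  have "(8 :: witt) = 5 + 1 + 1 + 1" by simp
  also have "\<dots> = 0" unfolding five_witt one_witt_def zero_witt_def by simp
  finally show ?thesis .
qed

lemma of_int_mod_8: "(of_int (a mod 8) :: witt) = of_int a"
proof -
  have "(of_int a :: witt) = of_int (8 * (a div 8) + a mod 8)" by simp
  also have "\<dots> = of_int (a mod 8)" unfolding of_int_add of_int_mult by (simp add: eight_witt)
  finally show ?thesis ..
qed

section \<open>The parity of the number of irreducible factors\<close>

lemma three_gf2_closure: "(3 :: gf2_closure) = 1"
proof -
  have "(3 :: gf2_closure) = 2 + 1" by (simp del: two_eq_0)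
  also have "\<dots> = 1" unfolding two_eq_0 by (rule add_0)
  finally show ?thesis .
qed

text \<open>
  In characteristic \<open>2\<close> the factor \<open>(3 - m) x - m\<close> is \<open>x\<close> or \<open>1\<close>, and neither \<open>0\<close> nor \<open>1\<close> is a root.
\<close>

lemma power_plus_cube_separable:
  fixes x :: gf2_closure
  assumes "m > 0" and root: "poly (power_plus_cube m) x = 0"
  shows "deriv_at (power_plus_cube m) x \<noteq> 0"
proof -
  have x: "x \<noteq> 0" using root assms(1) by (auto simp: poly_power_plus_cube power_0_left)
  have "x \<noteq> 1" using root by (auto simp: poly_power_plus_cube)
  then have x1: "x + 1 \<noteq> 0" by (metis char_2_left add.right_neutral add.commute)
  have "(3 - of_nat m) * x - of_nat m \<noteq> 0"
  proof (cases "even m")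
    case True
    then show ?thesis using x by (auto simp: three_gf2_closure elim!: evenE)
  next
    case False
    then show ?thesis by (auto simp: three_gf2_closure elim!: oddE)
  qed
  then have "x * deriv_at (power_plus_cube m) x \<noteq> 0"
    using deriv_at_power_plus_cube[OF root] assms(1) x1 by simp
  then show ?thesis by auto
qed

theorem theorem3p3:
  fixes m :: nat and f :: "gf2 poly"
  assumes "2 \<le> \<lfloor>real m / 2\<rfloor> - 1"
    and "f = monom 1 m + monom 1 3 + monom 1 2 + monom 1 1 + 1"
  shows "even (num_irreducible_factors f) \<longleftrightarrow> m mod 8 \<in> {0, 3, 5, 6}"
proof -
  have m: "m \<ge> 6" using assms(1) by linarith
  have "(2 :: gf2) = 0" using of_nat_card_eq_0[where 'a = bool] by simp
  moreover have "(3 :: gf2) = 2 + 1" by simp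
  ultimately have gf2_three: "(3 :: gf2) = 1" by (simp only: add_0)
  have f: "f = power_plus_cube m"
    unfolding assms(2) power_plus_cube_def unfolding gf2_three by (simp add: monom_0 one_pCons)
  have three: "res 3 = 1" "frob 3 = 3"
  proof -
    have "(3 :: witt) = 1 + 1 + 1" by simp
    then show "res 3 = 1" "frob 3 = 3" by (simp_all only: res_add res_1 frob_add frob_1 char_2 add_0)
  qed
  have f_closure: "map_poly to_ac f = power_plus_cube m"
    unfolding f power_plus_cube_def by (simp add: to_ac_poly.hom_add)
  have "\<exists>xs. (power_plus_cube m :: witt poly) = linear_factors xs \<and>
    vandermonde xs ^ 2 = (if even (degree f + num_irreducible_factors f) then 1 else 5)"
  proof (rule stickelberger_gf2)
    show "map_poly res (power_plus_cube m) = map_poly to_ac f"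
      unfolding f_closure unfolding power_plus_cube_def
      by (simp add: res_poly.hom_add three three_gf2_closure)
    show "lead_coeff (power_plus_cube m :: witt poly) = 1" using m by (intro monic_power_plus_cube) simp
    show "map_poly frob (power_plus_cube m) = power_plus_cube m"
      unfolding power_plus_cube_def by (simp add: frob_poly.hom_add three)
    fix x assume "poly (map_poly to_ac f) x = 0"
    then have root: "poly (power_plus_cube m) x = 0" by (simp only: f_closure)
    then show "deriv_at (map_poly to_ac f) x \<noteq> 0"
      unfolding f_closure using m by (intro power_plus_cube_separable) simp_all
  qed
  then obtain xs :: "witt list" where xs: "power_plus_cube m = linear_factors xs"
    and V: "vandermonde xs ^ 2 = (if even (degree f + num_irreducible_factors f) then 1 else 5)"
    by blast
  let ?N = "(int m ^ m + 27 * (3 - int m) ^ (m - 3))"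
  have "(- 1) ^ (m choose 2) * vandermonde xs ^ 2 = of_int ?N"
    using discriminant_power_plus_cube[OF _ xs] m by simp
  then have "(- 1) ^ (m choose 2) * ((- 1) ^ (m choose 2) * vandermonde xs ^ 2)
      = of_int ((- 1) ^ (m choose 2) * ?N)" by simp
  then have "vandermonde xs ^ 2 = of_int ((- 1) ^ (m choose 2) * ?N)"
    by (simp flip: mult.assoc power_mult_distrib)
  also have "\<dots> = of_int ((- 1) ^ (m choose 2) * ?N mod 8)" by (rule of_int_mod_8[symmetric])
  also have "\<dots> = (if even m \<longleftrightarrow> m mod 8 \<in> {0, 3, 5, 6} then 1 else 5)"
    by (simp only: discriminant_mod_8[OF m] if_distrib[of of_int] of_int_1 of_int_numeral)
  finally have "even (degree f + num_irreducible_factors f)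
      \<longleftrightarrow> (even m \<longleftrightarrow> m mod 8 \<in> {0, 3, 5, 6})"
    using V five_neq_1 by (auto split: if_splits)
  moreover have "degree f = m" unfolding f using m by (intro monic_power_plus_cube) simp
  ultimately show ?thesis by auto
qed

end
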